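(* Let $q$ be a prime power and $\nu\geq 1$ an integer. The symplectic inner product graph $Spi(2\nu,q)$ is connected if and only if $\nu\geq 2$. Moreover, if $Spi(2\nu,q)$ is connected, then its diameter is $4$.
   Context: $\mathbb{F}_q$ is the finite field with $q$ elements and $\mathbb{F}_q^{(2\nu)}$ is the space of row vectors of length $2\nu$ over $\mathbb{F}_q$. Let $K_{2\nu}=\begin{pmatrix}0 & I^{(\nu)}\\ -I^{(\nu)} & 0\end{pmatrix}$. A subspace $P$ of dimension $m$ is identified with any $m\times 2\nu$ matrix whose rows form a basis of $P$. The symplectic inner product graph $Spi(2\nu,q)$ has as vertex set all subspaces of $\mathbb{F}_q^{(2\nu)}$ other than $0$ and $\mathbb{F}_q^{(2\nu)}$, and vertices $A,B$ (not necessarily distinct) are adjacent iff $AK_{2\nu}{}^t B=0$, i.e. $\alpha K_{2\nu}{}^t\beta=0$ for all $\alpha\in A,\beta\in B$. A graph is connected if any two vertices are joined by a path; the distance between two vertices is the number of edges of a shortest path joining them, and the diameter is the greatest distance between two vertices. *)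

theory Defs
  imports
    "HOL-Analysis.Cartesian_Space"
    "HOL-Library.Extended_Nat"
    "Graph_Theory.Graph_Theory"
begin

text \<open>
  Row vectors of length \<open>2\<nu>\<close> are indexed by \<open>'n + 'n\<close> with \<open>\<nu> = CARD('n)\<close>: the summand
  \<open>Inl\<close> carries the first \<open>\<nu>\<close> coordinates and \<open>Inr\<close> the last \<open>\<nu>\<close> ones.
\<close>

definition sympl_K :: "'a::field ^ ('n::finite + 'n) ^ ('n + 'n)" where
  "sympl_K = (\<chi> i j. case (i, j) of
      (Inl k, Inr l) \<Rightarrow> (mat 1 :: 'a ^ 'n ^ 'n) $ k $ l
    | (Inr k, Inl l) \<Rightarrow> - ((mat 1 :: 'a ^ 'n ^ 'n) $ k $ l)
    | _ \<Rightarrow> 0)"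

definition sympl_form :: "'a::field ^ ('n::finite + 'n) \<Rightarrow> 'a ^ ('n + 'n) \<Rightarrow> 'a" where
  "sympl_form \<alpha> \<beta> = scalar_product (\<alpha> v* sympl_K) \<beta>"

text \<open>
  The undirected graph is the symmetric digraph having both arcs \<open>(A, B)\<close> and \<open>(B, A)\<close> for every
  edge. Totally isotropic subspaces carry a loop.
\<close>

definition Spi_verts :: "('a::field ^ ('n::finite + 'n)) set set" where
  "Spi_verts = {A. vec.subspace A \<and> A \<noteq> {0} \<and> A \<noteq> UNIV}"

definition Spi :: "'a::field itself \<Rightarrow> 'n::finite itself \<Rightarrow>
    (('a ^ ('n + 'n)) set, ('a ^ ('n + 'n)) set \<times> ('a ^ ('n + 'n)) set) pre_digraph" where
  "Spi _ _ = \<lparr>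
     verts = Spi_verts,
     arcs = {(A, B). A \<in> Spi_verts \<and> B \<in> Spi_verts \<and> (\<forall>\<alpha>\<in>A. \<forall>\<beta>\<in>B. sympl_form \<alpha> \<beta> = 0)},
     tail = fst,
     head = snd\<rparr>"

text \<open>The distance is \<open>\<infinity>\<close> if there is no path.\<close>

definition graph_dist :: "('v, 'e) pre_digraph \<Rightarrow> 'v \<Rightarrow> 'v \<Rightarrow> enat" where
  "graph_dist G u v = (INF p \<in> {p. pre_digraph.apath G u p v}. enat (length p))"

definition graph_diameter :: "('v, 'e) pre_digraph \<Rightarrow> enat" where
  "graph_diameter G = (SUP (u, v) \<in> verts G \<times> verts G. graph_dist G u v)"

lemma sympl_form_expand:
  "sympl_form \<alpha> \<beta> = (\<Sum>k\<in>UNIV. \<alpha> $ Inl k * \<beta> $ Inr k - \<alpha> $ Inr k * \<beta> $ Inl k)"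
proof -
  have l: "(\<alpha> v* sympl_K) $ Inl k = - \<alpha> $ Inr k" for k
    by (simp add: vector_matrix_mult_def sympl_K_def mat_def sum.Plus
        if_distrib sum_negf cong: if_cong flip: UNIV_Plus_UNIV)
  have r: "(\<alpha> v* sympl_K) $ Inr k = \<alpha> $ Inl k" for k
    by (simp add: vector_matrix_mult_def sympl_K_def mat_def sum.Plus
        if_distrib sum_negf cong: if_cong flip: UNIV_Plus_UNIV)
  show ?thesis
    by (simp add: sympl_form_def scalar_product_def sum.Plus l r sum_subtractf sum_negf
        flip: UNIV_Plus_UNIV)
qed

lemma sympl_form_skew: "sympl_form \<beta> \<alpha> = - sympl_form \<alpha> \<beta>"
  by (simp add: sympl_form_expand mult.commute flip: sum_negf)

lemma pseudo_graph_Spi: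
  "pseudo_graph (Spi TYPE('a::{field,finite}) TYPE('n::finite))"
proof
  show "symmetric (Spi TYPE('a) TYPE('n))"
    by (auto simp: symmetric_conv Spi_def) (metis sympl_form_skew neg_equal_0_iff_equal)
qed (auto simp: Spi_def)

end

theory Submission
  imports Defs
begin

text \<open>
  Every vertex \<open>A\<close> is adjacent to a line, since some nonzero linear functional vanishes on \<open>A\<close>
  and has the form \<open>sympl_form x\<close>. For \<open>\<nu> \<ge> 2\<close> any two vectors have a common nonzero orthogonal vector, so two
  vertices are joined through three lines by a walk of length 4. The bound is attained by the
  hyperplanes orthogonal to the two vectors of a hyperbolic pair: each of them has a single
  neighbour, and these two neighbours are distinct and not adjacent. For \<open>\<nu> = 1\<close> every vertex is a
  line, which is its own orthogonal complement and hence isolated.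
\<close>

section \<open>Walks, distance and connectedness in digraphs\<close>

lemma (in wf_digraph) graph_dist_le_awalk:
  assumes "awalk u p v"
  shows "graph_dist G u v \<le> enat (length p)"
  using assms
proof (induct rule: awalk_to_apath_induct)
  case (path p)
  then show ?case
    unfolding graph_dist_def by (intro INF_lower) (simp add: apath_def)
next
  case (decomp p q r s)
  \<comment> \<open>Cutting the cycle \<open>r\<close> out of \<open>p\<close> only shortens it.
    This lets walks that revisit vertices bound a distance defined through paths.\<close>
  then have "length (q @ s) \<le> length p"
    by (auto elim!: awalk_cyc_decompE)
  with decomp show ?case
    by (meson enat_ord_simps(1) order_trans)
qed

lemma (in wf_digraph) graph_dist_ge:
  assumes "\<And>p. awalk u p v \<Longrightarrow> n \<le> length p"
  shows "enat n \<le> graph_dist G u v"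
  unfolding graph_dist_def using assms by (intro INF_greatest) (auto simp: apath_def)

text \<open>\<open>connected\<close> ignores the direction of arcs. Every arc here has its reverse,
  so forgetting directions makes nothing new reachable.\<close>

lemma (in sym_digraph) connected_iff_strongly_connected:
  "connected G \<longleftrightarrow> strongly_connected G"
proof
  show "connected G \<Longrightarrow> strongly_connected G"
    by (rule symmetric_connected_imp_strongly_connected[OF sym_arcs])
  show "strongly_connected G \<Longrightarrow> connected G"
    by (auto simp: connected_def strongly_connected_def reachable_mk_symmetricI)
qed

section \<open>The symplectic form and orthogonal vectors\<close>

lemma sympl_form_scale_left: "sympl_form (c *s x) y = c * sympl_form x y"
  by (simp add: sympl_form_expand sum_distrib_left algebra_simps)

lemma sympl_form_scale_right: "sympl_form x (c *s y) = c * sympl_form x y"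
  by (simp add: sympl_form_expand sum_distrib_left algebra_simps)

lemma sympl_form_diff_right: "sympl_form x (y - z) = sympl_form x y - sympl_form x z"
  unfolding sympl_form_expand sum_subtractf[symmetric]
  by (intro sum.cong) (simp_all add: algebra_simps)

lemma sympl_form_self: "sympl_form x x = 0"
  by (simp add: sympl_form_expand mult.commute)

lemma sympl_form_axis_Inl: "sympl_form (axis (Inl k) 1) y = y $ Inr k"
  by (simp add: sympl_form_expand axis_def if_distrib if_distribR cong: if_cong)

lemma sympl_form_axis_Inr: "sympl_form (axis (Inr k) 1) y = - y $ Inl k"
  by (simp add: sympl_form_expand axis_def if_distrib if_distribR sum_negf cong: if_cong)

lemma proper_subspace_orthogonal_vector:
  fixes A :: "('a::field ^ ('n::finite + 'n)) set"
  assumes A: "vec.subspace A" and "A \<noteq> UNIV"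
  obtains x where "x \<noteq> 0" "\<And>v. v \<in> A \<Longrightarrow> sympl_form x v = 0"
proof -
  obtain S where S: "S \<subseteq> A" "vec.independent S" "A \<subseteq> vec.span S"
    using vec.maximal_independent_subset[of A] by metis
  have AS: "A = vec.span S"
    using S A by (simp add: subset_antisym vec.span_minimal)
  obtain u where u: "u \<notin> A"
    using assms by blast
  have "vec.independent (insert u S)"
    using S u AS by (simp add: vec.independent_insertI)
  \<comment> \<open>An endomorphism that fixes \<open>u\<close> and kills the basis \<open>S\<close>
    of \<open>A\<close>; a row of its matrix will serve as the functional.\<close>
  then obtain g :: "'a ^ ('n + 'n) \<Rightarrow> 'a ^ ('n + 'n)"
    where g: "Vector_Spaces.linear (*s) (*s) g" "\<And>v. v \<in> insert u S \<Longrightarrow> g v = (if v = u then u else 0)"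
    using vec.linear_independent_extend[of "insert u S" "\<lambda>v. if v = u then u else 0"] by blast
  have "u \<noteq> 0"
    using u A vec.subspace_0 by blast
  then obtain i where i: "u $ i \<noteq> 0"
    by (metis vec_eq_iff zero_index)
  \<comment> \<open>Row \<open>i\<close> of \<open>matrix g\<close> is a functional that vanishes on
    \<open>A\<close> but not at \<open>u\<close>. Swapping its two halves and negating the new
    second one undoes the action of \<open>sympl_K\<close>.\<close>
  define x :: "'a ^ ('n + 'n)" where
    "x = (\<chi> j. case j of Inl k \<Rightarrow> matrix g $ i $ Inr k | Inr k \<Rightarrow> - (matrix g $ i $ Inl k))"
  have gx: "g v $ i = sympl_form x v" for v
  proof -
    have "g v $ i = (\<Sum>j\<in>UNIV. matrix g $ i $ j * v $ j)"
      using matrix_works[OF g(1), of v] by (metis (no_types) matrix_vector_mult_def vec_lambda_beta)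
    also have "\<dots> = sympl_form x v"
      by (simp add: sympl_form_expand x_def sum.Plus sum.distrib flip: UNIV_Plus_UNIV)
    finally show ?thesis .
  qed
  have "sympl_form x v = 0" if "v \<in> A" for v
  proof -
    have "S \<subseteq> {v. g v = 0}"
      using g(2) S(1) u by auto
    moreover have "vec.subspace {v. g v = 0}"
      using g(1) by (rule vec.linear_subspace_kernel)
    ultimately have "A \<subseteq> {v. g v = 0}"
      unfolding AS by (rule vec.span_minimal)
    with that gx[of v] show ?thesis by auto
  qed
  moreover have "x \<noteq> 0"
    using gx[of u] g(2)[of u] i by (auto simp: sympl_form_expand)
  ultimately show ?thesis using that by blast
qed

text \<open>Pigeonhole: for \<nu> \<ge> 2 there are more vectors, q^(2\<nu>), than pairs of values,
  q^2. The difference of two vectors with the same pair is the required one. Independence of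
  \<open>x\<close> and \<open>y\<close> plays no part in the count.\<close>

lemma common_orthogonal_vector:
  fixes x y :: "'a::{field,finite} ^ ('n::finite + 'n)"
  assumes "CARD('n) \<ge> 2"
  obtains z where "z \<noteq> 0" "sympl_form x z = 0" "sympl_form y z = 0"
proof -
  let ?h = "\<lambda>v. (sympl_form x v, sympl_form y v)"
  have "CARD('a) > 1"
    using card_mono[of UNIV "{0, 1 :: 'a}"] by simp
  then have "CARD('a) ^ 2 < CARD('a) ^ (2 * CARD('n))"
    using assms by (intro power_strict_increasing) auto
  then have "CARD('a \<times> 'a) < CARD('a ^ ('n + 'n))"
    by (simp add: power2_eq_square mult_2)
  then have "\<not> inj ?h"
    using card_inj_on_le[of ?h UNIV UNIV] by fastforce
  then obtain v w where "v \<noteq> w" "?h v = ?h w"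
    by (auto simp: inj_def)
  then show ?thesis
    using that[of "v - w"] by (auto simp: sympl_form_diff_right)
qed

section \<open>Upper bound 4 on the distance\<close>

lemma line_in_Spi_verts:
  fixes x :: "'a::field ^ ('n::finite + 'n)"
  assumes "x \<noteq> 0"
  shows "vec.span {x} \<in> Spi_verts"
proof -
  have "vec.span {x} \<noteq> UNIV"
  proof
    \<comment> \<open>On a line the form vanishes identically, whereas a hyperbolic pair has value
      1.\<close>
    assume "vec.span {x} = UNIV"
    then obtain a b where "axis (Inl undefined) 1 = a *s x" "axis (Inr undefined) 1 = b *s x"
      by (metis UNIV_I vec.span_singleton rangeE)
    then have "sympl_form (axis (Inl undefined) 1 :: 'a ^ ('n + 'n)) (axis (Inr undefined) 1) = 0"
      by (simp add: sympl_form_scale_left sympl_form_scale_right sympl_form_self)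
    then show False
      by (simp add: sympl_form_axis_Inl)
  qed
  with assms show ?thesis
    by (auto simp: Spi_verts_def vec.subspace_span intro: vec.span_base)
qed

lemma Spi_simps:
  "verts (Spi TYPE('a::field) TYPE('n::finite)) = Spi_verts"
  "(A, B) \<in> arcs (Spi TYPE('a) TYPE('n)) \<longleftrightarrow>
     A \<in> Spi_verts \<and> B \<in> Spi_verts \<and> (\<forall>\<alpha>\<in>A. \<forall>\<beta>\<in>B. sympl_form \<alpha> \<beta> = 0)"
  "tail (Spi TYPE('a) TYPE('n)) = fst"
  "head (Spi TYPE('a) TYPE('n)) = snd"
  by (auto simp: Spi_def)

lemma wf_digraph_Spi: "wf_digraph (Spi TYPE('a::field) TYPE('n::finite))"
  by unfold_locales (auto simp: Spi_def)

lemma graph_dist_Spi_le_4: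
  fixes A B :: "('a::{field,finite} ^ ('n::finite + 'n)) set"
  assumes "CARD('n) \<ge> 2" and AB: "A \<in> Spi_verts" "B \<in> Spi_verts"
  shows "graph_dist (Spi TYPE('a) TYPE('n)) A B \<le> 4"
proof -
  interpret wf_digraph "Spi TYPE('a) TYPE('n)" by (rule wf_digraph_Spi)
  obtain x where x: "x \<noteq> 0" "\<And>v. v \<in> A \<Longrightarrow> sympl_form x v = 0"
    using proper_subspace_orthogonal_vector[of A] AB by (auto simp: Spi_verts_def)
  obtain y where y: "y \<noteq> 0" "\<And>v. v \<in> B \<Longrightarrow> sympl_form y v = 0"
    using proper_subspace_orthogonal_vector[of B] AB by (auto simp: Spi_verts_def)
  obtain z where z: "z \<noteq> 0" "sympl_form x z = 0" "sympl_form y z = 0"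
    using common_orthogonal_vector[OF assms(1), of x y] by blast
  have "sympl_form v x = 0" if "v \<in> A" for v
    using x(2)[OF that] sympl_form_skew[of v x] by simp
  moreover have "sympl_form z y = 0"
    using z(3) sympl_form_skew[of z y] by simp
  \<comment> \<open>The three lines may coincide with each other or with \<open>A\<close> or
    \<open>B\<close>, so this is a walk and not necessarily a path.\<close>
  ultimately have "awalk A [(A, vec.span {x}), (vec.span {x}, vec.span {z}),
      (vec.span {z}, vec.span {y}), (vec.span {y}, B)] B"
    using AB x y z line_in_Spi_verts[OF x(1)] line_in_Spi_verts[OF y(1)] line_in_Spi_verts[OF z(1)]
    by (auto simp: awalk_simps Spi_simps vec.span_singleton
        sympl_form_scale_left sympl_form_scale_right)
  from graph_dist_le_awalk[OF this] show ?thesis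
    by (simp add: numeral_eq_enat eval_nat_numeral)
qed

section \<open>Lower bound 4 from two coordinate hyperplanes\<close>

lemma coordinate_hyperplane_in_Spi_verts:
  fixes i :: "'n::finite + 'n"
  shows "{v :: 'a::field ^ ('n + 'n). v $ i = 0} \<in> Spi_verts"
proof -
  obtain j :: "'n + 'n" where "j \<noteq> i"
    by (metis Inl_Inr_False)
  then have "axis j 1 \<in> {v :: 'a ^ ('n + 'n). v $ i = 0} - {0}"
    by (auto simp: axis_def vec_eq_iff)
  moreover have "axis i 1 \<notin> {v :: 'a ^ ('n + 'n). v $ i = 0}"
    by simp
  moreover have "vec.subspace {v :: 'a ^ ('n + 'n). v $ i = 0}"
    by (simp add: vec.subspace_def)
  ultimately show ?thesis
    unfolding Spi_verts_def by blast
qed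

text \<open>Pairing \<open>c\<close> with a unit vector reads off, up to sign, the partner
  coordinate of \<open>c\<close>. The hyperplane contains every unit vector except the one at
  \<open>Inr k\<close>, whose partner is \<open>Inl k\<close>.\<close>

lemma orthogonal_Inr_hyperplane:
  fixes c :: "'a::field ^ ('n::finite + 'n)"
  assumes "\<And>v. v $ Inr k = 0 \<Longrightarrow> sympl_form v c = 0" and "j \<noteq> Inl k"
  shows "c $ j = 0"
proof (cases j)
  case (Inl l)
  with assms(2) have "axis (Inr l) (1 :: 'a) $ Inr k = 0"
    by (auto simp: axis_def)
  from assms(1)[OF this] Inl show ?thesis
    by (simp add: sympl_form_axis_Inr)
next
  case (Inr l)
  have "axis (Inl l) (1 :: 'a) $ Inr k = 0"
    by (simp add: axis_def)
  from assms(1)[OF this] Inr show ?thesis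
    by (simp add: sympl_form_axis_Inl)
qed

lemma orthogonal_Inl_hyperplane:
  fixes c :: "'a::field ^ ('n::finite + 'n)"
  assumes "\<And>v. v $ Inl k = 0 \<Longrightarrow> sympl_form v c = 0" and "j \<noteq> Inr k"
  shows "c $ j = 0"
proof (cases j)
  case (Inr l)
  with assms(2) have "axis (Inl l) (1 :: 'a) $ Inl k = 0"
    by (auto simp: axis_def)
  from assms(1)[OF this] Inr show ?thesis
    by (simp add: sympl_form_axis_Inl)
next
  case (Inl l)
  have "axis (Inr l) (1 :: 'a) $ Inl k = 0"
    by (simp add: axis_def)
  from assms(1)[OF this] Inl show ?thesis
    by (simp add: sympl_form_axis_Inr)
qed

text \<open>A neighbour is nonzero and orthogonal to the hyperplane, so it is the line through
  \<open>axis (Inl k) 1\<close>; this is recorded in coordinates.\<close>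

lemma neighbour_Inr_hyperplane:
  assumes "({v. v $ Inr k = 0}, C) \<in> arcs (Spi TYPE('a::field) TYPE('n::finite))"
  obtains c where "c \<in> C" "c $ Inl k \<noteq> 0" "\<And>c j. c \<in> C \<Longrightarrow> j \<noteq> Inl k \<Longrightarrow> c $ j = 0"
proof -
  have supp: "c $ j = 0" if "c \<in> C" "j \<noteq> Inl k" for c j
    using orthogonal_Inr_hyperplane[of k c j] assms that by (auto simp: Spi_simps)
  obtain c where "c \<in> C" "c \<noteq> 0"
    using assms by (force simp: Spi_simps Spi_verts_def vec.subspace_def)
  then show ?thesis
    using that supp by (metis vec_eq_iff zero_index)
qed

text \<open>The mirror image for the last arc of a walk: the hyperplane is the head, so
  skew-symmetry is applied first.\<close>

lemma neighbour_Inl_hyperplane: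
  assumes "(D, {v. v $ Inl k = 0}) \<in> arcs (Spi TYPE('a::field) TYPE('n::finite))"
  obtains d where "d \<in> D" "d $ Inr k \<noteq> 0" "\<And>d j. d \<in> D \<Longrightarrow> j \<noteq> Inr k \<Longrightarrow> d $ j = 0"
proof -
  have "sympl_form v d = 0" if "d \<in> D" "v $ Inl k = 0" for v d
    using assms that sympl_form_skew[of v d] by (simp add: Spi_simps)
  then have supp: "d $ j = 0" if "d \<in> D" "j \<noteq> Inr k" for d j
    using orthogonal_Inl_hyperplane[of k d j] that by blast
  obtain d where "d \<in> D" "d \<noteq> 0"
    using assms by (force simp: Spi_simps Spi_verts_def vec.subspace_def)
  then show ?thesis
    using that supp by (metis vec_eq_iff zero_index)
qed

text \<open>\<open>?A\<close> and \<open>?B\<close> are the orthogonal complements of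
  \<open>axis (Inl k) 1\<close> and \<open>axis (Inr k) 1\<close>. Walks of length 0, 1, 2 and 3 are
  excluded by \<open>neq\<close>, \<open>not_adj\<close>, \<open>not_dist2\<close> and
  \<open>not_dist3\<close>.\<close>

lemma graph_dist_hyperplanes_ge_4:
  fixes k :: "'n::finite"
  assumes "CARD('n) \<ge> 2"
  shows "4 \<le> graph_dist (Spi TYPE('a::field) TYPE('n)) {v. v $ Inr k = 0} {v. v $ Inl k = 0}"
    (is "4 \<le> graph_dist ?G ?A ?B")
proof -
  interpret wf_digraph ?G by (rule wf_digraph_Spi)
  have neq: "?A \<noteq> ?B"
  proof
    assume eq: "?A = ?B"
    have "axis (Inl k) 1 \<in> ?A" by (simp add: axis_def)
    with eq show False by simp
  qed
  have not_adj: "(?A, ?B) \<notin> arcs ?G"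
  proof
    assume adj: "(?A, ?B) \<in> arcs ?G"
    obtain l where "l \<noteq> k"
      using assms card_mono[of "{k}" "UNIV :: 'n set"] by fastforce
    then have "axis (Inl l) 1 \<in> ?A" "axis (Inr l) 1 \<in> ?B"
      by (simp_all add: axis_def)
    with adj have "sympl_form (axis (Inl l) 1) (axis (Inr l) 1 :: 'a ^ ('n + 'n)) = 0"
      by (auto simp: Spi_simps)
    then show False by (simp add: sympl_form_axis_Inl)
  qed
  \<comment> \<open>Adjacency to \<open>?A\<close> gives \<open>C\<close> a vector that is nonzero
    at \<open>Inl k\<close>; adjacency to \<open>?B\<close> forces that coordinate to be 0.\<close>
  have not_dist2: False if AC: "(?A, C) \<in> arcs ?G" and CB: "(C, ?B) \<in> arcs ?G" for C
    by (rule neighbour_Inr_hyperplane[OF AC], rule neighbour_Inl_hyperplane[OF CB]) blast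
  have not_dist3: False
    if AC: "(?A, C) \<in> arcs ?G" and CD: "(C, D) \<in> arcs ?G" and DB: "(D, ?B) \<in> arcs ?G" for C D
  proof -
    obtain c where c: "c \<in> C" "c $ Inl k \<noteq> 0" "\<And>j. j \<noteq> Inl k \<Longrightarrow> c $ j = 0"
      using neighbour_Inr_hyperplane[OF AC] by metis
    obtain d where d: "d \<in> D" "d $ Inr k \<noteq> 0" "\<And>j. j \<noteq> Inr k \<Longrightarrow> d $ j = 0"
      using neighbour_Inl_hyperplane[OF DB] by metis
    \<comment> \<open>With \<open>c\<close> supported at \<open>Inl k\<close> and \<open>d\<close>
      at \<open>Inr k\<close>, one product of nonzero entries survives.\<close>
    have "sympl_form c d = (\<Sum>l\<in>UNIV. if l = k then c $ Inl k * d $ Inr k else 0)"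
      unfolding sympl_form_expand using c(3) d(3) by (intro sum.cong) auto
    moreover have "sympl_form c d = 0"
      using CD c(1) d(1) by (auto simp: Spi_simps)
    ultimately show False using c(2) d(2) by simp
  qed
  have "4 \<le> length p" if walk: "awalk ?A p ?B" for p
  proof (rule ccontr)
    assume "\<not> 4 \<le> length p"
    then consider "p = []" | e where "p = [e]" | e f where "p = [e, f]" | e f g where "p = [e, f, g]"
      by (cases p; cases "tl p"; cases "tl (tl p)"; cases "tl (tl (tl p))") auto
    then show False
    proof cases
      case 1
      with walk neq show False by (simp add: awalk_simps)
    next
      case 2
      with walk not_adj show False
        by (auto simp: awalk_simps Spi_simps(3,4)) (metis prod.collapse)
    next
      case 3
      with walk show False
        using not_dist2[of "snd e"] by (auto simp: awalk_simps Spi_simps(3,4)) (metis prod.collapse)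
    next
      case 4
      with walk show False
        using not_dist3[of "snd e" "snd f"] by (auto simp: awalk_simps Spi_simps(3,4)) (metis prod.collapse)
    qed
  qed
  then have "enat 4 \<le> graph_dist ?G ?A ?B" by (rule graph_dist_ge)
  then show ?thesis by (simp add: numeral_eq_enat)
qed

section \<open>Diameter and connectedness\<close>

lemma graph_diameter_Spi:
  assumes "CARD('n::finite) \<ge> 2"
  shows "graph_diameter (Spi TYPE('a::{field,finite}) TYPE('n)) = 4"
proof (rule antisym)
  show "graph_diameter (Spi TYPE('a) TYPE('n)) \<le> 4"
    unfolding graph_diameter_def
    by (rule SUP_least) (auto simp: Spi_simps intro: graph_dist_Spi_le_4[OF assms])
  \<comment> \<open>\<open>undefined\<close> is an arbitrary index; it is the same in
    \<open>?A\<close> and \<open>?B\<close>, so that they belong to one hyperbolic pair.\<close>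
  let ?A = "{v :: 'a ^ ('n + 'n). v $ Inr undefined = 0}"
  let ?B = "{v :: 'a ^ ('n + 'n). v $ Inl undefined = 0}"
  have "graph_dist (Spi TYPE('a) TYPE('n)) ?A ?B \<le> graph_diameter (Spi TYPE('a) TYPE('n))"
    unfolding graph_diameter_def
    by (rule SUP_upper2[of "(?A, ?B)"]) (auto simp: Spi_simps coordinate_hyperplane_in_Spi_verts)
  with graph_dist_hyperplanes_ge_4[OF assms, where 'a = 'a, of undefined]
  show "4 \<le> graph_diameter (Spi TYPE('a) TYPE('n))" by (rule order_trans)
qed

text \<open>The distance bound suffices: without a path the infimum would be over the empty set,
  hence \<infinity>.\<close>

lemma strongly_connected_Spi:
  assumes "CARD('n::finite) \<ge> 2"
  shows "strongly_connected (Spi TYPE('a::{field,finite}) TYPE('n))"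
proof
  interpret wf_digraph "Spi TYPE('a) TYPE('n)" by (rule wf_digraph_Spi)
  show "verts (Spi TYPE('a) TYPE('n)) \<noteq> {}"
    using coordinate_hyperplane_in_Spi_verts by (auto simp: Spi_simps)
  fix A B assume "A \<in> verts (Spi TYPE('a) TYPE('n))" "B \<in> verts (Spi TYPE('a) TYPE('n))"
  then have "graph_dist (Spi TYPE('a) TYPE('n)) A B \<noteq> \<infinity>"
    using graph_dist_Spi_le_4[OF assms, of A B] by (auto simp: Spi_simps numeral_eq_enat enat_ile simp del: not_infinity_eq)
  then have "\<exists>p. apath A p B"
    unfolding graph_dist_def by (metis (mono_tags) Collect_empty_eq INF_empty top_enat_def image_empty)
  then show "A \<rightarrow>\<^sup>*\<^bsub>Spi TYPE('a) TYPE('n)\<^esub> B"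
    by (simp add: reachable_apath)
qed

lemma not_strongly_connected_Spi:
  assumes "CARD('n::finite) = 1"
  shows "\<not> strongly_connected (Spi TYPE('a::field) TYPE('n))"
proof
  let ?G = "Spi TYPE('a) TYPE('n)"
  interpret wf_digraph ?G by (rule wf_digraph_Spi)
  obtain k :: 'n where k: "UNIV = {k}"
    using assms by (auto simp: card_1_singleton_iff)
  let ?A = "{v :: 'a ^ ('n + 'n). v $ Inr k = 0}"
  let ?B = "{v :: 'a ^ ('n + 'n). v $ Inl k = 0}"
  assume "strongly_connected ?G"
  then have "?A \<rightarrow>\<^sup>*\<^bsub>?G\<^esub> ?B"
    by (auto simp: strongly_connected_def Spi_simps coordinate_hyperplane_in_Spi_verts)
  have isolated: "C = ?A" if AC: "(?A, C) \<in> arcs ?G" for C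
  proof -
    obtain c where c: "c \<in> C" "c $ Inl k \<noteq> 0" "\<And>c j. c \<in> C \<Longrightarrow> j \<noteq> Inl k \<Longrightarrow> c $ j = 0"
      using neighbour_Inr_hyperplane[OF AC] by metis
    have "v \<in> C" if "v $ Inr k = 0" for v
    proof -
      \<comment> \<open>For \<nu> = 1 only the coordinates \<open>Inl k\<close> and
        \<open>Inr k\<close> exist, and \<open>v\<close> and \<open>c\<close> both vanish at
        \<open>Inr k\<close>; so \<open>v\<close> is a multiple of \<open>c\<close>.\<close>
      have "v $ j = ((v $ Inl k / c $ Inl k) *s c) $ j" for j
      proof (cases "j = Inl k")
        case False
        moreover have "j = Inl k \<or> j = Inr k"
          using k by (cases j) (metis UNIV_I singletonD)+
        ultimately show ?thesis
          using that c(1,3) by simp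
      qed (use c(2) in simp)
      then have "v = (v $ Inl k / c $ Inl k) *s c"
        unfolding vec_eq_iff by blast
      moreover have "vec.subspace C"
        using AC by (simp add: Spi_simps Spi_verts_def)
      ultimately show ?thesis
        using c(1) by (metis vec.subspace_scale)
    qed
    with c(3) show ?thesis by auto
  qed
  \<comment> \<open>By induction along the walk, no walk from \<open>?A\<close> ever leaves it, so
    \<open>?B\<close> would have to equal \<open>?A\<close>.\<close>
  have "C = ?A" if "?A \<rightarrow>\<^sup>*\<^bsub>?G\<^esub> C" for C
    using that
  proof (induct rule: reachable_induct)
    case (step C D)
    then show ?case
      using isolated by (auto simp: arcs_ends_conv Spi_simps(3,4))
  qed simp
  from this[OF \<open>?A \<rightarrow>\<^sup>*\<^bsub>?G\<^esub> ?B\<close>] have "?B = ?A" .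
  moreover have "axis (Inl k) 1 \<in> ?A" by (simp add: axis_def)
  ultimately show False by (metis (mono_tags) axis_nth mem_Collect_eq zero_neq_one)
qed

theorem theorem2p1:
  fixes q \<nu> :: nat
  assumes "CARD('a::{field,finite}) = q"
    and "CARD('n::finite) = \<nu>"
  shows "(Digraph_Component.connected (Spi TYPE('a) TYPE('n)) \<longleftrightarrow> \<nu> \<ge> 2) \<and>
    (Digraph_Component.connected (Spi TYPE('a) TYPE('n)) \<longrightarrow>
      graph_diameter (Spi TYPE('a) TYPE('n)) = 4)"
proof -
  interpret pseudo_graph "Spi TYPE('a) TYPE('n)" by (rule pseudo_graph_Spi)
  \<comment> \<open>Types are nonempty, which supplies \<nu> \<ge> 1.\<close>
  have "\<nu> \<ge> 2 \<or> CARD('n) = 1"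
    using assms(2) zero_less_card_finite[where 'a = 'n] by linarith
  then show ?thesis
    using assms(2) strongly_connected_Spi not_strongly_connected_Spi graph_diameter_Spi
    by (auto simp: connected_iff_strongly_connected)
qed

end
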